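(* Let $R\in\{\mathbf{L},\mathbf{H}\}$ and let $S \subseteq R$ be finite and nonempty. Let $m_1, \ldots, m_t$ be the distinct minimal polynomials of all of the elements of $S$. For each $1 \leq i \leq t$, let $S_i = S \cap \mathcal{C}_R(m_i)$. Then $S$ is a ringset if and only if $S_i$ is a ringset for all $1 \leq i \leq t$.
   Context: Let $\mathbb{D}=\{a_0+a_1\mathbf{i}+a_2\mathbf{j}+a_3\mathbf{k} \mid a_0,\dots,a_3\in\mathbb{Q}\}$ be the division ring of rational quaternions, with $\mathbf{i}^2=\mathbf{j}^2=-1$ and $\mathbf{i}\mathbf{j}=\mathbf{k}=-\mathbf{j}\mathbf{i}$. Let $\mathbf{L}$ (Lipschitz quaternions) be the subring of elements with all $a_i\in\mathbb{Z}$, and $\mathbf{H}$ (Hurwitz quaternions) the subring of elements with either all $a_i\in\mathbb{Z}$ or all $a_i\in\mathbb{Z}+\frac12$. In $\mathbb{D}[x]$ the indeterminate $x$ is central, and polynomials are evaluated with coefficients on the left: for $f=\sum_i a_i x^i$ and $\alpha\in\mathbb{D}$, $f(\alpha)=\sum_i a_i\alpha^i$. For $S\subseteq R$, $\mathrm{Int}(S,R)=\{f\in\mathbb{D}[x]\mid f(S)\subseteq R\}$, and $S$ is a ringset (of $R$) if $\mathrm{Int}(S,R)$ is a subring of $\mathbb{D}[x]$. For $\alpha=a_0+a_1\mathbf{i}+a_2\mathbf{j}+a_3\mathbf{k}$, the norm is $N(\alpha)=a_0^2+a_1^2+a_2^2+a_3^2$. The minimal polynomial $\mu_\alpha$ of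 $\alpha$ is $x-\alpha$ if $\alpha\in\mathbb{Q}$, and $x^2-2a_0x+N(\alpha)$ if $\alpha\in\mathbb{D}\setminus\mathbb{Q}$; it has integer coefficients when $\alpha\in R$. For $m\in\mathbb{Z}[x]$ monic of degree 1 or 2, $\mathcal{C}_R(m)=\{\alpha\in R\mid\mu_\alpha=m\}$. *)

theory Defs
  imports
    "HOL-Computational_Algebra.Polynomial"
    "HOL-Algebra.Subrings"
    "HOL-Algebra.UnivPoly"
begin

section \<open>The division ring of rational quaternions\<close>

text \<open>\<open>Quat a0 a1 a2 a3\<close> stands for \<open>a0 + a1 i + a2 j + a3 k\<close>.\<close>

datatype rquat = Quat (qre: rat) (qi: rat) (qj: rat) (qk: rat)

lemma rquat_eq_iff: "x = y \<longleftrightarrow> qre x = qre y \<and> qi x = qi y \<and> qj x = qj y \<and> qk x = qk y"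
  by (auto intro: rquat.expand)

definition qnorm :: "rquat \<Rightarrow> rat" where
  "qnorm a = (qre a)\<^sup>2 + (qi a)\<^sup>2 + (qj a)\<^sup>2 + (qk a)\<^sup>2"

lemma qnorm_eq_0_iff: "qnorm a = 0 \<longleftrightarrow> qre a = 0 \<and> qi a = 0 \<and> qj a = 0 \<and> qk a = 0"
  unfolding qnorm_def by (simp add: add_nonneg_eq_0_iff)

instantiation rquat :: division_ring
begin

definition "0 = Quat 0 0 0 0"

definition "1 = Quat 1 0 0 0"

definition "a + b = Quat (qre a + qre b) (qi a + qi b) (qj a + qj b) (qk a + qk b)"

definition "- a = Quat (- qre a) (- qi a) (- qj a) (- qk a)"

definition "a - b = Quat (qre a - qre b) (qi a - qi b) (qj a - qj b) (qk a - qk b)"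

definition "a * b = Quat
   (qre a * qre b - qi a * qi b - qj a * qj b - qk a * qk b)
   (qre a * qi b + qi a * qre b + qj a * qk b - qk a * qj b)
   (qre a * qj b - qi a * qk b + qj a * qre b + qk a * qi b)
   (qre a * qk b + qi a * qj b - qj a * qi b + qk a * qre b)"

definition "inverse a =
   Quat (qre a / qnorm a) (- qi a / qnorm a) (- qj a / qnorm a) (- qk a / qnorm a)"

definition "a div b = a * inverse b" for a b :: rquat

lemmas rquat_defs = zero_rquat_def one_rquat_def plus_rquat_def uminus_rquat_def
  minus_rquat_def times_rquat_def

instance
proof
  fix a b c :: rquat
  show "a * b * c = a * (b * c)" by (simp add: rquat_defs algebra_simps)
  show "1 * a = a" "a * 1 = a" by (simp_all add: rquat_defs)
  show "a + b + c = a + (b + c)" "a + b = b + a" "0 + a = a" "- a + a = 0" "a - b = a + - b"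
    by (simp_all add: rquat_defs)
  show "(a + b) * c = a * c + b * c" "a * (b + c) = a * b + a * c"
    by (simp_all add: rquat_defs algebra_simps)
  show "(0::rquat) \<noteq> 1" by (simp add: rquat_defs)
  show "a div b = a * inverse b" by (rule divide_rquat_def)
  show "inverse (0::rquat) = 0" by (simp add: inverse_rquat_def rquat_defs)
  assume "a \<noteq> 0"
  then have n: "qnorm a \<noteq> 0" by (auto simp: qnorm_eq_0_iff rquat_defs rquat_eq_iff)
  have d: "qre a * qre a / qnorm a + qi a * qi a / qnorm a + qj a * qj a / qnorm a
      + qk a * qk a / qnorm a = 1"
    using n by (simp add: add_divide_distrib [symmetric] qnorm_def power2_eq_square)
  then show "inverse a * a = 1" "a * inverse a = 1"
    by (simp_all add: inverse_rquat_def rquat_defs)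
qed

end

lemma rquat_units:
  "Quat 0 1 0 0 * Quat 0 1 0 0 = - 1" "Quat 0 0 1 0 * Quat 0 0 1 0 = - 1"
  "Quat 0 1 0 0 * Quat 0 0 1 0 = Quat 0 0 0 1" "Quat 0 0 1 0 * Quat 0 1 0 0 = - Quat 0 0 0 1"
  by (simp_all add: rquat_defs)

definition rquat_ring :: "rquat ring" where
  "rquat_ring = \<lparr>carrier = UNIV, mult = (*), one = 1, zero = 0, add = (+)\<rparr>"

lemma rquat_ring_simps [simp]:
  "carrier rquat_ring = UNIV" "x \<otimes>\<^bsub>rquat_ring\<^esub> y = x * y" "\<one>\<^bsub>rquat_ring\<^esub> = 1"
  "\<zero>\<^bsub>rquat_ring\<^esub> = 0" "x \<oplus>\<^bsub>rquat_ring\<^esub> y = x + y"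
  by (simp_all add: rquat_ring_def)

lemma ring_rquat_ring: "ring rquat_ring"
proof (rule ringI)
  show "abelian_group rquat_ring"
    by (rule abelian_groupI) (auto simp: add_ac intro: exI [of _ "- x" for x]
        add.left_inverse)
  show "Group.monoid rquat_ring"
    by (rule monoidI) (auto simp: mult.assoc)
qed (auto simp: distrib_left distrib_right)

definition Lipschitz :: "rquat set" where
  "Lipschitz = {a. qre a \<in> \<int> \<and> qi a \<in> \<int> \<and> qj a \<in> \<int> \<and> qk a \<in> \<int>}"

definition half_Ints :: "rat set" where
  "half_Ints = {of_int n + 1 / 2 | n. True}"

definition Hurwitz :: "rquat set" where
  "Hurwitz = Lipschitz \<union>
     {a. qre a \<in> half_Ints \<and> qi a \<in> half_Ints \<and> qj a \<in> half_Ints \<and> qk a \<in> half_Ints}"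

section \<open>Integer-valued polynomials and ringsets\<close>

text \<open>
  The polynomial ring \<open>D[x]\<close> with central indeterminate is \<^term>\<open>UP rquat_ring\<close>, whose
  multiplication is convolution of coefficients over a not necessarily commutative ring.
  \<^const>\<open>eval\<close> places the coefficients to the left of the powers of the argument.
\<close>

lemma ring_UP_rquat: "ring (UP rquat_ring)"
proof -
  interpret UP_ring rquat_ring "UP rquat_ring"
    by (simp add: UP_ring_def ring_rquat_ring)
  show ?thesis by (rule UP_ring)
qed

lemma eval_rquat:
  assumes "f \<in> carrier (UP rquat_ring)"
  shows "eval rquat_ring rquat_ring (\<lambda>c. c) a f = (\<Sum>i\<le>deg rquat_ring f. f i * a ^ i)"
proof -
  interpret R: ring rquat_ring by (rule ring_rquat_ring)
  have pow: "a [^]\<^bsub>rquat_ring\<^esub> i = a ^ i" for i :: nat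
    by (induction i) (simp_all add: power_commutes)
  have fin: "finsum rquat_ring g A = sum g A" if "finite A" for g :: "nat \<Rightarrow> rquat" and A
    using that by (induction A) (simp_all add: R.finsum_insert)
  show ?thesis
    using assms by (simp add: eval_def fin pow UP_def)
qed

definition Int_polys :: "rquat set \<Rightarrow> rquat set \<Rightarrow> (nat \<Rightarrow> rquat) set" where
  "Int_polys S R =
     {f \<in> carrier (UP rquat_ring). \<forall>a\<in>S. eval rquat_ring rquat_ring (\<lambda>c. c) a f \<in> R}"

definition ringset :: "rquat set \<Rightarrow> rquat set \<Rightarrow> bool" where
  "ringset R S \<longleftrightarrow> subring (Int_polys S R) (UP rquat_ring)"

section \<open>Minimal polynomials\<close>

text \<open>
  Minimal polynomials are polynomials over the centre of \<open>D\<close>, so they are given the type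
  \<^typ>\<open>rat poly\<close>. For Lipschitz and Hurwitz quaternions the coefficients are integers.
\<close>

definition min_poly :: "rquat \<Rightarrow> rat poly" where
  "min_poly a = (if qi a = 0 \<and> qj a = 0 \<and> qk a = 0
     then [:- qre a, 1:] else [:qnorm a, - 2 * qre a, 1:])"

lemma min_poly_Ints:
  assumes "a \<in> Hurwitz"
  shows "Polynomial.coeff (min_poly a) n \<in> \<int>"
proof -
  consider "a \<in> Lipschitz" | p q r s where "a = Quat (of_int p + 1 / 2) (of_int q + 1 / 2)
      (of_int r + 1 / 2) (of_int s + 1 / 2)"
    using assms unfolding Hurwitz_def half_Ints_def by (cases a) auto
  then have "qnorm a \<in> \<int> \<and> 2 * qre a \<in> \<int> \<and> (qi a = 0 \<longrightarrow> qre a \<in> \<int>)"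
  proof cases
    case 1
    then show ?thesis
      by (auto simp: Lipschitz_def qnorm_def)
  next
    case 2
    have "qnorm a = of_int (p\<^sup>2 + p + q\<^sup>2 + q + r\<^sup>2 + r + s\<^sup>2 + s + 1)"
      by (simp add: 2 qnorm_def power2_eq_square algebra_simps)
    then have "qnorm a \<in> \<int>" by (simp only: Ints_of_int)
    moreover have "2 * qre a = of_int (2 * p + 1)" by (simp add: 2)
    then have "2 * qre a \<in> \<int>" by (simp only: Ints_of_int)
    moreover have "of_int (2 * q + 1) \<noteq> (0 :: rat)" unfolding of_int_eq_0_iff by presburger
    moreover have "of_int (2 * q + 1) = 2 * qi a" by (simp add: 2)
    ultimately show ?thesis by auto
  qed
  then show ?thesis
    by (auto simp: min_poly_def coeff_pCons split: nat.split)
qed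

definition min_poly_class :: "rquat set \<Rightarrow> rat poly \<Rightarrow> rquat set" where
  "min_poly_class R m = {a \<in> R. min_poly a = m}"

end

theory Submission
  imports Defs "HOL-Computational_Algebra.Polynomial_Factorial"
    "HOL-Computational_Algebra.Field_as_Ring"
begin

text \<open>
  Polynomials with rational coefficients are central in \<open>D[x]\<close>, so multiplying \<open>f\<close> by such a \<open>p\<close>
  multiplies every value \<open>f(a)\<close> by \<open>p(a)\<close> (\<open>qeval_central_mult\<close>). Minimal polynomials are
  irreducible over the rationals because \<open>D\<close> has no zero divisors, so the distinct ones among a
  finite set \<open>S\<close> are pairwise coprime, and the Chinese remainder theorem over the rationals gives a
  \<open>p\<close> with value 1 on the elements of \<open>S\<close> with a chosen minimal polynomial and value 0 on the other
  elements of \<open>S\<close> (\<open>separating_polynomial\<close>).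

  Let \<open>T\<close> be the part of \<open>S\<close> on which \<open>p\<close> is 1. Multiplication by \<open>p\<close> then carries
  \<open>Int(T, R)\<close> into \<open>Int(S, R)\<close> without changing values on \<open>T\<close>. The values of \<open>fg\<close> on \<open>T\<close>
  are those of \<open>(pf)(pg)\<close>, so they lie in \<open>R\<close> as soon as \<open>S\<close> is a ringset; the same argument
  covers sums and negatives (\<open>ringset_separated_subset\<close>). Conversely, \<open>Int(S, R)\<close> is the
  intersection of the sets \<open>Int(T, R)\<close> over the parts \<open>T\<close> of \<open>S\<close>, and an intersection of subrings
  is a subring.
\<close>

section \<open>Evaluation in the polynomial ring over the quaternions\<close>

abbreviation DX :: "(rquat, nat \<Rightarrow> rquat) up_ring" where
  "DX \<equiv> UP rquat_ring"

abbreviation qeval :: "rquat \<Rightarrow> (nat \<Rightarrow> rquat) \<Rightarrow> rquat" where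
  "qeval a f \<equiv> eval rquat_ring rquat_ring (\<lambda>c. c) a f"

interpretation DX: UP_ring rquat_ring DX
  by (simp add: UP_ring_def ring_rquat_ring)

interpretation DX: ring DX
  by (rule ring_UP_rquat)

lemma finsum_rquat: "finite A \<Longrightarrow> finsum rquat_ring g A = sum g A" for g :: "nat \<Rightarrow> rquat"
  by (induction A rule: finite_induct) (simp_all add: DX.R.finsum_insert)

lemma coeff_DX: "f \<in> carrier DX \<Longrightarrow> up_ring.coeff DX f = f"
  by (simp add: UP_def)

lemma DX_add: "f \<in> carrier DX \<Longrightarrow> g \<in> carrier DX \<Longrightarrow> (f \<oplus>\<^bsub>DX\<^esub> g) n = f n + g n"
  using DX.coeff_add[of f g n] by (simp add: coeff_DX)

lemma DX_mult:
  "f \<in> carrier DX \<Longrightarrow> g \<in> carrier DX \<Longrightarrow> (f \<otimes>\<^bsub>DX\<^esub> g) n = (\<Sum>i\<le>n. f i * g (n - i))"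
  using DX.coeff_mult[of f g n] by (simp add: coeff_DX finsum_rquat)

lemma DX_zero: "\<zero>\<^bsub>DX\<^esub> n = 0"
  using DX.coeff_zero[of n] by (simp add: coeff_DX)

lemma DX_carrierI: "(\<And>i. i > n \<Longrightarrow> f i = 0) \<Longrightarrow> f \<in> carrier DX"
  unfolding UP_def by (auto simp: up_def bound_def intro!: exI[of _ n])

lemma DX_above_deg: "f \<in> carrier DX \<Longrightarrow> deg rquat_ring f < n \<Longrightarrow> f n = 0"
  using DX.deg_aboveD[of f n] by (simp add: coeff_DX)

text \<open>
  Truncating at any bound not below the degree lets several polynomials be summed over one range, and
  spares computing the exact degree.
\<close>

lemma qeval_sum_bound:
  assumes "f \<in> carrier DX" and "\<And>i. i > n \<Longrightarrow> f i = 0"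
  shows "qeval a f = (\<Sum>i\<le>n. f i * a ^ i)"
proof -
  have "deg rquat_ring f \<le> n"
    using assms by (intro DX.deg_aboveI) (auto simp: coeff_DX)
  then have "(\<Sum>i\<le>deg rquat_ring f. f i * a ^ i) = (\<Sum>i\<le>n. f i * a ^ i)"
    using assms by (intro sum.mono_neutral_left) (auto simp: DX_above_deg)
  then show ?thesis
    by (simp add: eval_rquat assms)
qed

lemma qeval_add:
  assumes "f \<in> carrier DX" "g \<in> carrier DX"
  shows "qeval a (f \<oplus>\<^bsub>DX\<^esub> g) = qeval a f + qeval a g"
proof -
  define n where "n = max (deg rquat_ring f) (deg rquat_ring g)"
  have "f i = 0" "g i = 0" if "i > n" for i
    using that assms by (auto simp: n_def DX_above_deg)
  then have "qeval a h = (\<Sum>i\<le>n. h i * a ^ i)" if "h \<in> {f, g, f \<oplus>\<^bsub>DX\<^esub> g}" for h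
    using that assms by (intro qeval_sum_bound) (auto simp: DX_add)
  then show ?thesis
    using assms by (simp add: DX_add distrib_right sum.distrib)
qed

lemma qeval_zero: "qeval a \<zero>\<^bsub>DX\<^esub> = 0"
  by (subst qeval_sum_bound[where n = 0]) (auto simp: DX_zero)

lemma qeval_minus:
  assumes "f \<in> carrier DX"
  shows "qeval a (\<ominus>\<^bsub>DX\<^esub> f) = - qeval a f"
proof -
  have "qeval a f + qeval a (\<ominus>\<^bsub>DX\<^esub> f) = 0"
    using assms by (simp add: qeval_zero DX.r_neg flip: qeval_add)
  then show ?thesis
    by (simp add: eq_neg_iff_add_eq_0 add.commute)
qed

text \<open>
  Evaluation is not multiplicative: with coefficients on the left, \<open>g(a)\<close> lands between the
  coefficients of \<open>f\<close> and the powers of \<open>a\<close>. In particular \<open>(fg)(a)\<close> depends on \<open>g\<close> only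
  through \<open>g(a)\<close>.
\<close>

lemma qeval_mult:
  assumes f: "f \<in> carrier DX" and g: "g \<in> carrier DX"
  shows "qeval a (f \<otimes>\<^bsub>DX\<^esub> g) = (\<Sum>i\<le>deg rquat_ring f. f i * qeval a g * a ^ i)"
proof -
  let ?p = "deg rquat_ring f" and ?q = "deg rquat_ring g"
  have "(f \<otimes>\<^bsub>DX\<^esub> g) n = 0" if "n > ?p + ?q" for n
  proof -
    have "f i * g (n - i) = 0" if "i \<le> n" for i
      using \<open>n > ?p + ?q\<close> f g by (cases "i > ?p") (auto simp: DX_above_deg)
    then have "(\<Sum>i\<le>n. f i * g (n - i)) = 0"
      by (intro sum.neutral) auto
    then show ?thesis
      by (simp add: DX_mult f g)
  qed
  \<comment> \<open>Writing the exponent \<open>n\<close> as \<open>i + (n - i)\<close> makes the summand a function of \<open>i\<close> and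
      \<open>n - i\<close>, the form in which the summation by diagonals can be undone.\<close>
  then have "qeval a (f \<otimes>\<^bsub>DX\<^esub> g) = (\<Sum>n\<le>?p + ?q. \<Sum>i\<le>n. f i * g (n - i) * a ^ (i + (n - i)))"
    using f g by (subst qeval_sum_bound) (auto simp: DX_mult sum_distrib_right intro!: sum.cong)
  also have "\<dots> = (\<Sum>(i, j)\<in>{(i, j). i + j \<le> ?p + ?q}. f i * g j * a ^ (i + j))"
    by (rule sum.triangle_reindex_eq[symmetric, of "\<lambda>i j. f i * g j * a ^ (i + j)"])
  also have "\<dots> = (\<Sum>(i, j)\<in>{..?p} \<times> {..?q}. f i * g j * a ^ (i + j))"
  proof (rule sum.mono_neutral_right)
    show "finite {(i, j). i + j \<le> ?p + ?q}"
      by (rule finite_subset[of _ "{..?p + ?q} \<times> {..?p + ?q}"]) auto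
    show "{..?p} \<times> {..?q} \<subseteq> {(i, j). i + j \<le> ?p + ?q}"
      by auto
    have "f i * g j = 0" if "(i, j) \<notin> {..?p} \<times> {..?q}" for i j
      using that f g DX_above_deg[of f i] DX_above_deg[of g j] by (cases "i \<le> ?p") auto
    then show "\<forall>x\<in>{(i, j). i + j \<le> ?p + ?q} - {..?p} \<times> {..?q}.
        (case x of (i, j) \<Rightarrow> f i * g j * a ^ (i + j)) = 0"
      by fastforce
  qed
  also have "\<dots> = (\<Sum>i\<le>?p. \<Sum>j\<le>?q. f i * (g j * a ^ j) * a ^ i)"
  proof -
    have "a ^ (i + j) = a ^ j * a ^ i" for i j
      by (metis add.commute power_add)
    then show ?thesis
      by (simp add: mult.assoc flip: sum.cartesian_product)
  qed
  also have "\<dots> = (\<Sum>i\<le>?p. f i * qeval a g * a ^ i)"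
    using g by (simp add: eval_rquat sum_distrib_left sum_distrib_right)
  finally show ?thesis .
qed

section \<open>Rational polynomials as central elements\<close>

definition central :: "rat poly \<Rightarrow> nat \<Rightarrow> rquat" where
  "central p n = Quat (Polynomial.coeff p n) 0 0 0"

lemma central_carrier [simp]: "central p \<in> carrier DX"
  by (rule DX_carrierI[of "degree p"]) (simp add: central_def coeff_eq_0 zero_rquat_def)

lemma rational_commute: "Quat c 0 0 0 * x = x * Quat c 0 0 0"
  by (simp add: rquat_defs mult.commute)

lemma qeval_central_bound:
  "degree p \<le> n \<Longrightarrow> qeval a (central p) = (\<Sum>i\<le>n. Quat (Polynomial.coeff p i) 0 0 0 * a ^ i)"
  by (subst qeval_sum_bound[where n = n]) (auto simp: central_def coeff_eq_0 zero_rquat_def)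

text \<open>
  Rational coefficients commute past \<open>f(a)\<close>, which can therefore be pulled out of the sum of
  \<open>qeval_mult\<close> on the left.
\<close>

lemma qeval_central_mult:
  assumes f: "f \<in> carrier DX"
  shows "qeval a (central p \<otimes>\<^bsub>DX\<^esub> f) = qeval a f * qeval a (central p)"
proof -
  have "qeval a (central p \<otimes>\<^bsub>DX\<^esub> f)
      = (\<Sum>i\<le>deg rquat_ring (central p). qeval a f * (central p i * a ^ i))"
    unfolding qeval_mult[OF central_carrier f] central_def rational_commute[of _ "qeval a f"]
    by (simp add: mult.assoc)
  then show ?thesis
    by (simp add: eval_rquat sum_distrib_left)
qed

lemma qeval_central_one: "qeval a (central 1) = 1"
  by (simp add: qeval_central_bound[of 1 0] one_rquat_def)

lemma qeval_central_add: "qeval a (central (p + q)) = qeval a (central p) + qeval a (central q)"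
proof -
  have "central (p + q) = central p \<oplus>\<^bsub>DX\<^esub> central q"
    by (rule ext) (simp add: DX_add central_def plus_rquat_def)
  then show ?thesis
    by (simp add: qeval_add)
qed

lemma qeval_central_times: "qeval a (central (p * q)) = qeval a (central q) * qeval a (central p)"
proof -
  have sum_Quat: "(\<Sum>i\<in>A. Quat (h i) 0 0 0) = Quat (sum h A) 0 0 0" if "finite A"
    for h :: "nat \<Rightarrow> rat" and A
    using that by (induction A) (simp_all add: zero_rquat_def plus_rquat_def)
  have "central (p * q) = central p \<otimes>\<^bsub>DX\<^esub> central q"
    by (rule ext) (simp add: DX_mult central_def times_rquat_def sum_Quat Polynomial.coeff_mult)
  then show ?thesis
    by (simp add: qeval_central_mult)
qed

section \<open>Minimal polynomials\<close>

lemma monic_min_poly: "lead_coeff (min_poly a) = 1"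
  by (simp add: min_poly_def)

lemma qeval_min_poly: "qeval a (central (min_poly a)) = 0"
  by (simp add: qeval_central_bound[of _ 2] min_poly_def numeral_2_eq_2)
    (auto simp: rquat_defs qnorm_def power2_eq_square algebra_simps)

text \<open>
  If \<open>c + d a = 0\<close> with rational \<open>c\<close> and \<open>d \<noteq> 0\<close>, then \<open>a\<close> is rational. So the formula that
  defines \<^const>\<open>min_poly\<close> has the least possible degree, and division with remainder then
  describes all rational polynomials that vanish at \<open>a\<close>.
\<close>

lemma min_poly_minimal:
  assumes "qeval a (central p) = 0" and "degree p < degree (min_poly a)"
  shows "p = 0"
proof -
  have "degree p \<le> 1"
    using assms(2) by (auto simp: min_poly_def split: if_splits)
  then have p: "p = [:Polynomial.coeff p 0, Polynomial.coeff p 1:]"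
    by (auto simp: poly_eq_iff coeff_pCons coeff_eq_0 split: nat.split)
  have "Quat (Polynomial.coeff p 0) 0 0 0 + Quat (Polynomial.coeff p 1) 0 0 0 * a = 0"
    using assms(1) \<open>degree p \<le> 1\<close> by (simp add: qeval_central_bound[of _ 1])
  moreover have "Polynomial.coeff p 1 = 0" if "qi a = 0 \<and> qj a = 0 \<and> qk a = 0"
    using assms(2) that by (auto simp: min_poly_def coeff_eq_0)
  ultimately have "Polynomial.coeff p 0 = 0 \<and> Polynomial.coeff p 1 = 0"
    by (auto simp: rquat_defs)
  then show ?thesis
    using p by simp
qed

lemma min_poly_dvd_iff: "min_poly a dvd p \<longleftrightarrow> qeval a (central p) = 0"
proof
  assume "min_poly a dvd p"
  then show "qeval a (central p) = 0"
    by (auto simp: dvd_def qeval_central_times qeval_min_poly)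
next
  assume 0: "qeval a (central p) = 0"
  have "qeval a (central (p div min_poly a * min_poly a + p mod min_poly a)) = 0"
    using 0 by simp
  then have "qeval a (central (p mod min_poly a)) = 0"
    unfolding qeval_central_add by (simp add: qeval_central_times qeval_min_poly)
  moreover have "p mod min_poly a = 0 \<or> degree (p mod min_poly a) < degree (min_poly a)"
    using monic_min_poly[of a] by (intro degree_mod_less) auto
  ultimately show "min_poly a dvd p"
    using min_poly_minimal by (auto simp: mod_eq_0_iff_dvd)
qed

text \<open>
  This is irreducibility in the form needed below. A factorization \<open>\<mu>\<^sub>a = d e\<close> gives
  \<open>e(a) d(a) = 0\<close> in a division ring, so \<open>\<mu>\<^sub>a\<close> already divides one of the two factors. For
  \<open>d = gcd \<mu>\<^sub>a p\<close> the two cases are the two alternatives.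
\<close>

lemma min_poly_dvd_or_coprime: "min_poly a dvd p \<or> coprime (min_poly a) p"
proof -
  define d where "d = gcd (min_poly a) p"
  then obtain e where e: "min_poly a = d * e"
    by (metis gcd_dvd1 dvdE)
  have "d * e \<noteq> 0"
    using monic_min_poly[of a] e by auto
  have "qeval a (central e) * qeval a (central d) = 0"
    using qeval_min_poly[of a] by (simp add: e qeval_central_times)
  then consider "min_poly a dvd d" | "min_poly a dvd e"
    unfolding min_poly_dvd_iff by auto
  then show ?thesis
  proof cases
    case 1
    then show ?thesis by (simp add: d_def)
  next
    case 2
    then have "d * e dvd 1 * e"
      by (simp add: e)
    then have "is_unit d"
      using \<open>d * e \<noteq> 0\<close> by (subst (asm) dvd_times_right_cancel_iff) auto
    then show ?thesis
      by (simp add: d_def coprime_iff_gcd_eq_1)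
  qed
qed

lemma coprime_min_poly:
  assumes "min_poly a \<noteq> min_poly b"
  shows "coprime (min_poly a) (min_poly b)"
proof (rule ccontr)
  assume "\<not> coprime (min_poly a) (min_poly b)"
  then have "min_poly a dvd min_poly b" "min_poly b dvd min_poly a"
    using min_poly_dvd_or_coprime[of a "min_poly b"] min_poly_dvd_or_coprime[of b "min_poly a"]
    by (auto simp: coprime_commute)
  moreover have "normalize (min_poly c) = min_poly c" for c
    by (simp add: normalize_poly_eq_map_poly monic_min_poly)
  ultimately have "min_poly a = min_poly b"
    by (simp add: associated_eqI)
  with assms show False ..
qed

text \<open>
  The Chinese remainder theorem: \<open>m\<close> is coprime to the product of the other minimal polynomials,
  and the summand \<open>v \<Prod>A\<close> of a Bezout relation \<open>u m + v \<Prod>A = 1\<close> is the required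
  polynomial. If no element of \<open>S\<close> has minimal polynomial \<open>m\<close>, the zero polynomial will do.
\<close>

lemma separating_polynomial:
  assumes "finite S"
  obtains p where
    "\<And>a. a \<in> S \<Longrightarrow> min_poly a = m \<Longrightarrow> qeval a (central p) = 1"
    "\<And>a. a \<in> S \<Longrightarrow> min_poly a \<noteq> m \<Longrightarrow> qeval a (central p) = 0"
proof (cases "m \<in> min_poly ` S")
  case True
  define A where "A = min_poly ` S - {m}"
  have fin: "finite A"
    using assms by (simp add: A_def)
  have "coprime m (prod (\<lambda>q. q) A)"
    using True by (intro prod_coprime_right) (auto simp: A_def intro: coprime_min_poly)
  then obtain u v where uv: "u * m + v * \<Prod>A = 1"
    by (metis bezout_coefficients_fst_snd coprime_iff_gcd_eq_1)
  show ?thesis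
  proof
    fix a
    assume a: "a \<in> S"
    show "qeval a (central (v * \<Prod>A)) = 1" if "min_poly a = m"
    proof -
      have "qeval a (central (u * m)) = 0"
        using that by (simp flip: min_poly_dvd_iff)
      then show ?thesis
        using qeval_central_add[of a "u * m" "v * \<Prod>A"] by (simp add: uv qeval_central_one)
    qed
    show "qeval a (central (v * \<Prod>A)) = 0" if "min_poly a \<noteq> m"
    proof -
      have "min_poly a dvd \<Prod>A"
        using that a fin by (intro dvd_prodI[where f = "\<lambda>x. x", simplified]) (auto simp: A_def)
      then show ?thesis
        by (simp flip: min_poly_dvd_iff)
    qed
  qed
next
  case False
  show ?thesis
  proof
    show "qeval a (central 0) = 1" if "a \<in> S" "min_poly a = m" for a
      using False that by auto
    show "qeval a (central 0) = 0" for a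
      by (simp flip: min_poly_dvd_iff)
  qed
qed

section \<open>Ringsets\<close>

lemma mem_Int_polys: "f \<in> Int_polys S R \<longleftrightarrow> f \<in> carrier DX \<and> (\<forall>a\<in>S. qeval a f \<in> R)"
  by (simp add: Int_polys_def)

lemma ringset_UN:
  assumes "I \<noteq> {}" and "\<And>i. i \<in> I \<Longrightarrow> ringset R (T i)"
  shows "ringset R (\<Union>i\<in>I. T i)"
proof -
  have "Int_polys (\<Union>i\<in>I. T i) R = (\<Inter>i\<in>I. Int_polys (T i) R)"
    using assms(1) by (auto simp: mem_Int_polys)
  then show ?thesis
    using assms by (auto simp: ringset_def intro!: DX.subring_Inter)
qed

text \<open>
  Multiplication by \<open>p\<close> extends an element of \<open>Int(T, R)\<close> by zero to an element of
  \<open>Int(S, R)\<close> with the same values on \<open>T\<close>. Membership in \<open>Int(T, R)\<close> is a matter of values on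
  \<open>T\<close>, so each closure property can be checked on the extensions, where it holds because
  \<open>Int(S, R)\<close> is a subring. Extension by zero stays inside \<open>R\<close> because \<open>Int(S, R)\<close> contains
  the zero polynomial, so that \<open>0 \<in> R\<close> unless \<open>S\<close> is empty.
\<close>

lemma ringset_separated_subset:
  assumes S: "ringset R S" and T: "T \<subseteq> S"
    and one: "\<And>a. a \<in> T \<Longrightarrow> qeval a (central p) = 1"
    and zero: "\<And>a. a \<in> S - T \<Longrightarrow> qeval a (central p) = 0"
  shows "ringset R T"
proof -
  note I = subringE[OF S[unfolded ringset_def]]
  have sub: "Int_polys S R \<subseteq> Int_polys T R"
    using T unfolding Int_polys_def by blast
  have zero_R: "0 \<in> R" if "a \<in> S" for a
    using I(2) that by (auto simp: mem_Int_polys qeval_zero)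
  have extension: "central p \<otimes>\<^bsub>DX\<^esub> f \<in> Int_polys S R" if f: "f \<in> Int_polys T R" for f
  proof -
    have "qeval a (central p \<otimes>\<^bsub>DX\<^esub> f) \<in> R" if "a \<in> S" for a
      using f that zero_R one zero
      by (cases "a \<in> T") (auto simp: mem_Int_polys qeval_central_mult)
    then show ?thesis
      using f by (simp add: mem_Int_polys)
  qed
  have val: "qeval a (central p \<otimes>\<^bsub>DX\<^esub> f) = qeval a f" if "f \<in> carrier DX" "a \<in> T" for f a
    using that one by (simp add: qeval_central_mult)
  show ?thesis
    unfolding ringset_def
  proof (rule DX.subringI)
    show "Int_polys T R \<subseteq> carrier DX"
      by (auto simp: mem_Int_polys)
    show "\<one>\<^bsub>DX\<^esub> \<in> Int_polys T R"
      using I(3) sub by blast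
  next
    fix f assume f: "f \<in> Int_polys T R"
    then have fc: "f \<in> carrier DX" by (simp add: mem_Int_polys)
    have "qeval a (\<ominus>\<^bsub>DX\<^esub> f) = qeval a (\<ominus>\<^bsub>DX\<^esub> (central p \<otimes>\<^bsub>DX\<^esub> f))" if "a \<in> T" for a
      using fc that by (simp add: qeval_minus val)
    then show "\<ominus>\<^bsub>DX\<^esub> f \<in> Int_polys T R"
      using I(5)[OF extension[OF f]] fc T by (auto simp: mem_Int_polys)
  next
    fix f g assume f: "f \<in> Int_polys T R" and g: "g \<in> Int_polys T R"
    then have fc: "f \<in> carrier DX" "g \<in> carrier DX" by (simp_all add: mem_Int_polys)
    let ?F = "central p \<otimes>\<^bsub>DX\<^esub> f" and ?G = "central p \<otimes>\<^bsub>DX\<^esub> g"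
    have "qeval a (f \<oplus>\<^bsub>DX\<^esub> g) = qeval a (?F \<oplus>\<^bsub>DX\<^esub> ?G)" if "a \<in> T" for a
      using fc that by (simp add: qeval_add val)
    then show "f \<oplus>\<^bsub>DX\<^esub> g \<in> Int_polys T R"
      using I(7)[OF extension[OF f] extension[OF g]] fc T by (auto simp: mem_Int_polys)
    have "qeval a (f \<otimes>\<^bsub>DX\<^esub> g) = qeval a (?F \<otimes>\<^bsub>DX\<^esub> ?G)" if "a \<in> T" for a
    proof -
      \<comment> \<open>The left factor \<open>p\<close> is central and can be split off directly; the inner one disappears
          because the product depends on \<open>pg\<close> only through its value at \<open>a\<close>.\<close>
      have "qeval a (?F \<otimes>\<^bsub>DX\<^esub> ?G) = qeval a (f \<otimes>\<^bsub>DX\<^esub> ?G)"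
        using fc that by (simp add: DX.m_assoc val)
      also have "\<dots> = qeval a (f \<otimes>\<^bsub>DX\<^esub> g)"
        unfolding qeval_mult[OF fc(1) DX.m_closed[OF central_carrier fc(2)]] qeval_mult[OF fc]
        using fc(2) that by (simp only: val)
      finally show ?thesis ..
    qed
    then show "f \<otimes>\<^bsub>DX\<^esub> g \<in> Int_polys T R"
      using I(6)[OF extension[OF f] extension[OF g]] fc T by (auto simp: mem_Int_polys)
  qed
qed

theorem corollary2p2:
  fixes R S :: "rquat set" and m :: "nat \<Rightarrow> rat poly" and t :: nat
  assumes "R \<in> {Lipschitz, Hurwitz}"
    and "finite S" and "S \<noteq> {}" and "S \<subseteq> R"
    and "bij_betw m {1..t} (min_poly ` S)"
  shows "ringset R S \<longleftrightarrow> (\<forall>i\<in>{1..t}. ringset R (S \<inter> min_poly_class R (m i)))"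
proof
  assume S: "ringset R S"
  show "\<forall>i\<in>{1..t}. ringset R (S \<inter> min_poly_class R (m i))"
  proof
    fix i
    obtain p where
      one: "\<And>a. a \<in> S \<Longrightarrow> min_poly a = m i \<Longrightarrow> qeval a (central p) = 1" and
      zero: "\<And>a. a \<in> S \<Longrightarrow> min_poly a \<noteq> m i \<Longrightarrow> qeval a (central p) = 0"
      using separating_polynomial[OF assms(2)] by blast
    have mem: "a \<in> S \<inter> min_poly_class R (m i) \<longleftrightarrow> a \<in> S \<and> min_poly a = m i" for a
      using assms(4) by (auto simp: min_poly_class_def)
    show "ringset R (S \<inter> min_poly_class R (m i))"
      using S
    proof (rule ringset_separated_subset)
      show "qeval a (central p) = 1" if "a \<in> S \<inter> min_poly_class R (m i)" for a
        using that one unfolding mem by blast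
      show "qeval a (central p) = 0" if "a \<in> S - S \<inter> min_poly_class R (m i)" for a
        using that zero unfolding Diff_iff mem by blast
    qed simp
  qed
next
  assume "\<forall>i\<in>{1..t}. ringset R (S \<inter> min_poly_class R (m i))"
  moreover have image: "m ` {1..t} = min_poly ` S"
    using assms(5) by (rule bij_betw_imp_surj_on)
  ultimately have "ringset R (\<Union>i\<in>{1..t}. S \<inter> min_poly_class R (m i))"
    using assms(3) by (intro ringset_UN) auto
  also have "(\<Union>i\<in>{1..t}. S \<inter> min_poly_class R (m i)) = S"
  proof -
    have "\<exists>i\<in>{1..t}. min_poly a = m i" if "a \<in> S" for a
      using image that by (metis imageE imageI)
    then show ?thesis
      using assms(4) by (auto simp: min_poly_class_def)
  qed
  finally show "ringset R S" .
qed

end
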